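(* For every set of formulas $\Gamma\cup\{\varphi\}\subseteq \mathbf{F}(\Sigma_{\mathbf{nbI}},\mathcal V)$: if $\Gamma\vDash_{\mathbf{nbI}}\varphi$ then $\Gamma\vdash_{\mathbf{nbI}}\varphi$.
   Context: Let $\mathcal V$ be a countable set of propositional variables and $\Sigma_{\mathbf{nbI}}=\{\vee,\wedge,\rightarrow,\uparrow,\neg\}$ with $\neg$ unary and the other connectives binary; $\mathbf F(\Sigma_{\mathbf{nbI}},\mathcal V)$ is the set of formulas. The logic $\mathbf{nbI}$ is the Hilbert calculus whose only inference rule is Modus Ponens and whose axioms are all instances (with arbitrary formulas) of: (1) $\alpha\to(\beta\to\alpha)$; (2) $(\alpha\to(\beta\to\gamma))\to((\alpha\to\beta)\to(\alpha\to\gamma))$; (3) $\alpha\to(\beta\to(\alpha\wedge\beta))$; (4) $(\alpha\wedge\beta)\to\alpha$; (5) $(\alpha\wedge\beta)\to\beta$; (6) $\alpha\to(\alpha\vee\beta)$; (7) $\beta\to(\alpha\vee\beta)$; (8) $(\alpha\to\gamma)\to((\beta\to\gamma)\to((\alpha\vee\beta)\to\gamma))$; (9) $(\alpha\to\beta)\vee\alpha$; (Ip) $(\alpha\uparrow\beta)\to(\alpha\to(\beta\to\gamma))$; (Comm) $(\alpha\uparrow\beta)\to(\beta\uparrow\alpha)$; (11) $\alpha\vee\neg\alpha$. $\Gamma\vdash_{\mathbf{nbI}}\varphi$ means that there is a finite derivation of $\varphi$ from premises in $\Gamma$. A bivaluation for $\mathbf{nbI}$ is a map $\nu:\mathbf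 F(\Sigma_{\mathbf{nbI}},\mathcal V)\to\{0,1\}$ such that for all formulas $\alpha,\beta$: $\nu(\alpha\vee\beta)=1$ iff $\nu(\alpha)=1$ or $\nu(\beta)=1$; $\nu(\alpha\wedge\beta)=1$ iff $\nu(\alpha)=\nu(\beta)=1$; $\nu(\alpha\to\beta)=1$ iff $\nu(\alpha)=0$ or $\nu(\beta)=1$; if $\nu(\alpha\uparrow\beta)=1$ then $\nu(\alpha)=0$ or $\nu(\beta)=0$; $\nu(\alpha\uparrow\beta)=\nu(\beta\uparrow\alpha)$; if $\nu(\neg\alpha)=0$ then $\nu(\alpha)=1$. $\Gamma\vDash_{\mathbf{nbI}}\varphi$ means: for every bivaluation $\nu$ for $\mathbf{nbI}$, if $\nu(\gamma)=1$ for all $\gamma\in\Gamma$ then $\nu(\varphi)=1$. *)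

theory Defs
  imports Main "HOL-Library.Countable"
begin

datatype 'v form =
    Var 'v
  | Or "'v form" "'v form"  (infixr "\<^bold>\<or>" 60)
  | And "'v form" "'v form"  (infixr "\<^bold>\<and>" 65)
  | Imp "'v form" "'v form"  (infixr "\<^bold>\<rightarrow>" 55)
  | Up "'v form" "'v form"  (infix "\<^bold>\<up>" 70)
  | Neg "'v form"  ("\<^bold>\<not> _" [75] 75)

inductive_set nbI_axioms :: "'v form set" where
  Ax1: "\<alpha> \<^bold>\<rightarrow> (\<beta> \<^bold>\<rightarrow> \<alpha>) \<in> nbI_axioms"
| Ax2: "(\<alpha> \<^bold>\<rightarrow> (\<beta> \<^bold>\<rightarrow> \<gamma>)) \<^bold>\<rightarrow> ((\<alpha> \<^bold>\<rightarrow> \<beta>) \<^bold>\<rightarrow> (\<alpha> \<^bold>\<rightarrow> \<gamma>)) \<in> nbI_axioms"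
| Ax3: "\<alpha> \<^bold>\<rightarrow> (\<beta> \<^bold>\<rightarrow> (\<alpha> \<^bold>\<and> \<beta>)) \<in> nbI_axioms"
| Ax4: "(\<alpha> \<^bold>\<and> \<beta>) \<^bold>\<rightarrow> \<alpha> \<in> nbI_axioms"
| Ax5: "(\<alpha> \<^bold>\<and> \<beta>) \<^bold>\<rightarrow> \<beta> \<in> nbI_axioms"
| Ax6: "\<alpha> \<^bold>\<rightarrow> (\<alpha> \<^bold>\<or> \<beta>) \<in> nbI_axioms"
| Ax7: "\<beta> \<^bold>\<rightarrow> (\<alpha> \<^bold>\<or> \<beta>) \<in> nbI_axioms"
| Ax8: "(\<alpha> \<^bold>\<rightarrow> \<gamma>) \<^bold>\<rightarrow> ((\<beta> \<^bold>\<rightarrow> \<gamma>) \<^bold>\<rightarrow> ((\<alpha> \<^bold>\<or> \<beta>) \<^bold>\<rightarrow> \<gamma>)) \<in> nbI_axioms"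
| Ax9: "(\<alpha> \<^bold>\<rightarrow> \<beta>) \<^bold>\<or> \<alpha> \<in> nbI_axioms"
| Ip: "(\<alpha> \<^bold>\<up> \<beta>) \<^bold>\<rightarrow> (\<alpha> \<^bold>\<rightarrow> (\<beta> \<^bold>\<rightarrow> \<gamma>)) \<in> nbI_axioms"
| Comm: "(\<alpha> \<^bold>\<up> \<beta>) \<^bold>\<rightarrow> (\<beta> \<^bold>\<up> \<alpha>) \<in> nbI_axioms"
| Ax11: "\<alpha> \<^bold>\<or> \<^bold>\<not> \<alpha> \<in> nbI_axioms"

definition nbI_derivation :: "'v form set \<Rightarrow> 'v form list \<Rightarrow> bool" where
  "nbI_derivation \<Gamma> ds \<longleftrightarrow>
     (\<forall>i < length ds. ds ! i \<in> \<Gamma> \<or> ds ! i \<in> nbI_axioms \<or>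
        (\<exists>j < i. \<exists>k < i. ds ! k = ds ! j \<^bold>\<rightarrow> ds ! i))"

definition nbI_derives :: "'v form set \<Rightarrow> 'v form \<Rightarrow> bool"  (infix "\<turnstile>nbI" 50) where
  "\<Gamma> \<turnstile>nbI \<phi> \<longleftrightarrow> (\<exists>ds. nbI_derivation \<Gamma> ds \<and> ds \<noteq> [] \<and> last ds = \<phi>)"

(* The truth values 1 and 0 are rendered as True and False. *)
definition nbI_bivaluation :: "('v form \<Rightarrow> bool) \<Rightarrow> bool" where
  "nbI_bivaluation \<nu> \<longleftrightarrow> (\<forall>\<alpha> \<beta>.
     (\<nu> (\<alpha> \<^bold>\<or> \<beta>) \<longleftrightarrow> \<nu> \<alpha> \<or> \<nu> \<beta>) \<and>
     (\<nu> (\<alpha> \<^bold>\<and> \<beta>) \<longleftrightarrow> \<nu> \<alpha> \<and> \<nu> \<beta>) \<and>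
     (\<nu> (\<alpha> \<^bold>\<rightarrow> \<beta>) \<longleftrightarrow> \<not> \<nu> \<alpha> \<or> \<nu> \<beta>) \<and>
     (\<nu> (\<alpha> \<^bold>\<up> \<beta>) \<longrightarrow> \<not> \<nu> \<alpha> \<or> \<not> \<nu> \<beta>) \<and>
     \<nu> (\<alpha> \<^bold>\<up> \<beta>) = \<nu> (\<beta> \<^bold>\<up> \<alpha>) \<and>
     (\<not> \<nu> (\<^bold>\<not> \<alpha>) \<longrightarrow> \<nu> \<alpha>))"

definition nbI_entails :: "'v form set \<Rightarrow> 'v form \<Rightarrow> bool"  (infix "\<Turnstile>nbI" 50) where
  "\<Gamma> \<Turnstile>nbI \<phi> \<longleftrightarrow> (\<forall>\<nu>. nbI_bivaluation \<nu> \<longrightarrow> (\<forall>\<gamma>\<in>\<Gamma>. \<nu> \<gamma>) \<longrightarrow> \<nu> \<phi>)"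

end

theory Submission
  imports Defs
begin

text \<open>
  Completeness is proved by contraposition, along the lines of the Lindenbaum--Asser argument.
  If \<open>\<phi>\<close> is not derivable from \<open>\<Gamma>\<close>, Zorn's lemma extends \<open>\<Gamma>\<close> to a set \<open>\<Delta>\<close> that is maximal among
  the sets not deriving \<open>\<phi>\<close>, and the characteristic function of \<open>\<Delta>\<close> is a bivaluation that
  satisfies \<open>\<Gamma>\<close> and refutes \<open>\<phi>\<close>.

  The connective \<open>\<^bold>\<not>\<close> obeys excluded middle but does not explode, so implication of \<open>\<phi>\<close> takes the
  place of negation: by the deduction theorem, \<open>\<alpha> \<notin> \<Delta>\<close> means exactly that \<open>\<Delta>\<close> derives
  \<open>\<alpha> \<^bold>\<rightarrow> \<phi>\<close>. Each clause in the definition of a bivaluation then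
  reflects axioms of the calculus. Elimination of disjunction makes \<open>\<Delta>\<close> prime; given primeness,
  \<open>(\<alpha> \<^bold>\<rightarrow> \<beta>) \<^bold>\<or> \<alpha>\<close> puts every implication into \<open>\<Delta>\<close> whose antecedent is outside, and
  \<open>\<alpha> \<^bold>\<or> \<^bold>\<not> \<alpha>\<close> puts one of \<open>\<alpha>\<close> and \<open>\<^bold>\<not> \<alpha>\<close> into \<open>\<Delta>\<close>. The axiom
  \<open>(\<alpha> \<^bold>\<up> \<beta>) \<^bold>\<rightarrow> (\<alpha> \<^bold>\<rightarrow> (\<beta> \<^bold>\<rightarrow> \<gamma>))\<close>, taken at \<open>\<gamma> = \<phi>\<close>, prevents \<open>\<Delta>\<close> from containing \<open>\<alpha> \<^bold>\<up> \<beta>\<close>,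
  \<open>\<alpha>\<close> and \<open>\<beta>\<close> together. The values of \<open>\<^bold>\<not>\<close> and \<open>\<^bold>\<up>\<close> are not determined by those of their
  arguments; the valuation is therefore given by membership in \<open>\<Delta>\<close> on all formulas at once, and
  not extended from the variables by recursion.
\<close>

text \<open>
  Derivability is recast as an inductive predicate, so that the deduction theorem and the
  compactness property of chains become rule inductions instead of manipulations of lists.
\<close>
inductive provable :: "'v form set \<Rightarrow> 'v form \<Rightarrow> bool" for \<Gamma> where
  premise: "\<alpha> \<in> \<Gamma> \<Longrightarrow> provable \<Gamma> \<alpha>"
| axiom: "\<alpha> \<in> nbI_axioms \<Longrightarrow> provable \<Gamma> \<alpha>"
| mp: "provable \<Gamma> (\<alpha> \<^bold>\<rightarrow> \<beta>) \<Longrightarrow> provable \<Gamma> \<alpha> \<Longrightarrow> provable \<Gamma> \<beta>"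

lemma nbI_derivation_append:
  assumes "nbI_derivation \<Gamma> xs" "nbI_derivation \<Gamma> ys"
  shows "nbI_derivation \<Gamma> (xs @ ys)"
  unfolding nbI_derivation_def
proof (intro allI impI)
  fix i assume i: "i < length (xs @ ys)"
  let ?ok = "\<lambda>ds i. ds ! i \<in> \<Gamma> \<or> ds ! i \<in> nbI_axioms \<or>
    (\<exists>j < i. \<exists>k < i. ds ! k = ds ! j \<^bold>\<rightarrow> ds ! i)"
  show "?ok (xs @ ys) i"
  proof (cases "i < length xs")
    case True
    then have "?ok xs i" using assms(1) by (simp add: nbI_derivation_def)
    moreover have "(xs @ ys) ! j = xs ! j" if "j \<le> i" for j
      using that True by (simp add: nth_append)
    ultimately show ?thesis by (metis order.refl less_imp_le)
  next
    case False
    define m where "m = i - length xs"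
    have im: "i = length xs + m" "m < length ys" using False i by (auto simp: m_def)
    then have "?ok ys m" using assms(2) by (simp add: nbI_derivation_def)
    moreover have "\<exists>j < i. \<exists>k < i. (xs @ ys) ! k = (xs @ ys) ! j \<^bold>\<rightarrow> (xs @ ys) ! i"
      if "j < m" "k < m" "ys ! k = ys ! j \<^bold>\<rightarrow> ys ! m" for j k
      using that im
      by (intro exI[of _ "length xs + j"] conjI exI[of _ "length xs + k"]) simp_all
    moreover have "(xs @ ys) ! i = ys ! m" using im by simp
    ultimately show ?thesis by metis
  qed
qed

lemma nbI_derivation_snoc:
  assumes "nbI_derivation \<Gamma> ds"
    and "\<alpha> \<in> \<Gamma> \<or> \<alpha> \<in> nbI_axioms \<or> (\<exists>\<beta> \<in> set ds. \<beta> \<^bold>\<rightarrow> \<alpha> \<in> set ds)"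
  shows "nbI_derivation \<Gamma> (ds @ [\<alpha>])"
  unfolding nbI_derivation_def
proof (intro allI impI)
  fix i assume "i < length (ds @ [\<alpha>])"
  then consider (old) "i < length ds" | (new) "i = length ds" by fastforce
  then show "(ds @ [\<alpha>]) ! i \<in> \<Gamma> \<or> (ds @ [\<alpha>]) ! i \<in> nbI_axioms \<or>
    (\<exists>j < i. \<exists>k < i. (ds @ [\<alpha>]) ! k = (ds @ [\<alpha>]) ! j \<^bold>\<rightarrow> (ds @ [\<alpha>]) ! i)"
  proof cases
    case old
    moreover have "(ds @ [\<alpha>]) ! j = ds ! j" if "j \<le> i" for j
      using that old by (simp add: nth_append)
    ultimately show ?thesis
      using assms(1) unfolding nbI_derivation_def by (metis order.refl less_imp_le)
  next
    case new
    then show ?thesis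
      using assms(2) by (metis in_set_conv_nth nth_append nth_append_length)
  qed
qed

lemma provable_imp_derives: "provable \<Gamma> \<alpha> \<Longrightarrow> \<Gamma> \<turnstile>nbI \<alpha>"
proof (induction rule: provable.induct)
  case (premise \<alpha>)
  then show ?case
    by (auto simp: nbI_derives_def nbI_derivation_def intro!: exI[of _ "[\<alpha>]"])
next
  case (axiom \<alpha>)
  then show ?case
    by (auto simp: nbI_derives_def nbI_derivation_def intro!: exI[of _ "[\<alpha>]"])
next
  case (mp \<alpha> \<beta>)
  then obtain xs ys where xs: "nbI_derivation \<Gamma> xs" "xs \<noteq> []" "last xs = \<alpha> \<^bold>\<rightarrow> \<beta>"
    and ys: "nbI_derivation \<Gamma> ys" "ys \<noteq> []" "last ys = \<alpha>"
    by (auto simp: nbI_derives_def)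
  have "\<alpha> \<^bold>\<rightarrow> \<beta> \<in> set (xs @ ys)" "\<alpha> \<in> set (xs @ ys)"
    using xs ys last_in_set by fastforce+
  then have "nbI_derivation \<Gamma> ((xs @ ys) @ [\<beta>])"
    using nbI_derivation_append[OF xs(1) ys(1)] by (intro nbI_derivation_snoc) auto
  then show ?case unfolding nbI_derives_def by force
qed

lemma provable_mono: "provable \<Gamma> \<alpha> \<Longrightarrow> \<Gamma> \<subseteq> \<Delta> \<Longrightarrow> provable \<Delta> \<alpha>"
  by (induction rule: provable.induct) (blast intro: premise, blast intro: axiom, metis mp)

lemma provable_weaken: "provable \<Gamma> \<beta> \<Longrightarrow> provable \<Gamma> (\<alpha> \<^bold>\<rightarrow> \<beta>)"
  by (rule mp[OF axiom[OF Ax1]])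

lemma deduction_theorem: "provable (insert \<alpha> \<Gamma>) \<beta> \<Longrightarrow> provable \<Gamma> (\<alpha> \<^bold>\<rightarrow> \<beta>)"
proof (induction rule: provable.induct)
  case (premise \<beta>)
  \<comment> \<open>The identity \<open>\<alpha> \<^bold>\<rightarrow> \<alpha>\<close> is the combinator S K K.\<close>
  have "provable \<Gamma> (\<alpha> \<^bold>\<rightarrow> \<alpha>)"
    using mp[OF mp[OF axiom[OF Ax2] axiom[OF Ax1]] axiom[OF Ax1[of \<alpha> \<alpha>]]] .
  with premise show ?case by (auto intro: provable_weaken provable.premise)
next
  case (axiom \<beta>)
  then show ?case by (intro provable_weaken provable.axiom)
next
  case (mp \<beta> \<gamma>)
  show ?case by (rule provable.mp[OF provable.mp[OF provable.axiom[OF Ax2] mp.IH(1)] mp.IH(2)])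
qed

text \<open>
  A proof has only finitely many premises, and finitely many members of the union of a chain
  already lie in one member of the chain.
\<close>
lemma provable_Union_chain:
  assumes "provable (\<Union>\<C>) \<alpha>" and chain: "subset.chain \<S> \<C>" and "\<C> \<noteq> {}"
  shows "\<exists>A \<in> \<C>. provable A \<alpha>"
  using assms(1)
proof (induction rule: provable.induct)
  case (premise \<alpha>)
  then show ?case by (auto intro: provable.premise)
next
  case (axiom \<alpha>)
  then show ?case using \<open>\<C> \<noteq> {}\<close> by (auto intro: provable.axiom)
next
  case (mp \<alpha> \<beta>)
  then obtain A B where AB: "A \<in> \<C>" "B \<in> \<C>" "provable A (\<alpha> \<^bold>\<rightarrow> \<beta>)" "provable B \<alpha>" by blast
  then have "A \<subseteq> B \<or> B \<subseteq> A" using chain by (auto simp: subset_chain_def)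
  then show ?case using AB by (meson provable.mp provable_mono)
qed

definition maximal_unprovable :: "'v form set \<Rightarrow> 'v form \<Rightarrow> bool" where
  "maximal_unprovable \<Delta> \<phi> \<longleftrightarrow>
     \<not> provable \<Delta> \<phi> \<and> (\<forall>\<alpha>. \<alpha> \<notin> \<Delta> \<longrightarrow> provable (insert \<alpha> \<Delta>) \<phi>)"

lemma lindenbaum:
  assumes "\<not> provable \<Gamma> \<phi>"
  obtains \<Delta> where "\<Gamma> \<subseteq> \<Delta>" "maximal_unprovable \<Delta> \<phi>"
proof -
  let ?\<S> = "{\<Delta>. \<Gamma> \<subseteq> \<Delta> \<and> \<not> provable \<Delta> \<phi>}"
  have "\<exists>M \<in> ?\<S>. \<forall>X \<in> ?\<S>. M \<subseteq> X \<longrightarrow> X = M"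
  proof (rule subset_Zorn_nonempty)
    show "?\<S> \<noteq> {}" using assms by auto
    fix \<C> assume \<C>: "\<C> \<noteq> {}" "subset.chain ?\<S> \<C>"
    then have "\<C> \<subseteq> ?\<S>" by (auto simp: subset.chain_def)
    moreover have "\<not> provable (\<Union>\<C>) \<phi>"
      using provable_Union_chain[OF _ \<C>(2,1)] \<open>\<C> \<subseteq> ?\<S>\<close> by blast
    ultimately show "\<Union>\<C> \<in> ?\<S>" using \<C>(1) by blast
  qed
  then obtain M where "M \<in> ?\<S>" and max: "\<forall>X \<in> ?\<S>. M \<subseteq> X \<longrightarrow> X = M" ..
  then have M: "\<Gamma> \<subseteq> M" "\<not> provable M \<phi>" by simp_all
  have "provable (insert \<alpha> M) \<phi>" if "\<alpha> \<notin> M" for \<alpha>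
  proof (rule ccontr)
    assume "\<not> provable (insert \<alpha> M) \<phi>"
    then have "insert \<alpha> M \<in> ?\<S>" using M(1) by auto
    with max have "insert \<alpha> M = M" by (meson subset_insertI)
    with that show False by blast
  qed
  with M(2) have "maximal_unprovable M \<phi>" by (simp add: maximal_unprovable_def)
  with M(1) show thesis by (rule that)
qed

lemma maximal_unprovable_notin:
  "maximal_unprovable \<Delta> \<phi> \<Longrightarrow> \<alpha> \<notin> \<Delta> \<Longrightarrow> provable \<Delta> (\<alpha> \<^bold>\<rightarrow> \<phi>)"
  by (auto simp: maximal_unprovable_def intro: deduction_theorem)

text \<open>A provable formula outside \<open>\<Delta>\<close> would, by modus ponens, yield \<open>\<phi>\<close>.\<close>
lemma maximal_unprovable_closed:
  "maximal_unprovable \<Delta> \<phi> \<Longrightarrow> provable \<Delta> \<alpha> \<longleftrightarrow> \<alpha> \<in> \<Delta>"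
  using mp[OF maximal_unprovable_notin] premise by (auto simp: maximal_unprovable_def)

text \<open>
  If both disjuncts were outside \<open>\<Delta>\<close>, each would imply \<open>\<phi>\<close>, and reasoning by cases would derive
  \<open>\<phi>\<close> from the disjunction.
\<close>
lemma maximal_unprovable_prime:
  assumes \<Delta>: "maximal_unprovable \<Delta> \<phi>" and "\<alpha> \<^bold>\<or> \<beta> \<in> \<Delta>"
  shows "\<alpha> \<in> \<Delta> \<or> \<beta> \<in> \<Delta>"
proof (rule ccontr)
  assume "\<not> ?thesis"
  then have "provable \<Delta> (\<alpha> \<^bold>\<rightarrow> \<phi>)" "provable \<Delta> (\<beta> \<^bold>\<rightarrow> \<phi>)"
    using maximal_unprovable_notin[OF \<Delta>] by auto
  then have "provable \<Delta> \<phi>"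
    by (rule mp[OF mp[OF mp[OF axiom[OF Ax8]]] premise[OF assms(2)]])
  with \<Delta> show False by (simp add: maximal_unprovable_def)
qed

lemma maximal_unprovable_bivaluation:
  assumes \<Delta>: "maximal_unprovable \<Delta> \<phi>"
  shows "nbI_bivaluation (\<lambda>\<alpha>. \<alpha> \<in> \<Delta>)"
proof -
  note closed = maximal_unprovable_closed[OF \<Delta>]
  have ax: "\<alpha> \<in> \<Delta>" if "\<alpha> \<in> nbI_axioms" for \<alpha>
    using axiom[OF that] closed by blast
  have mp: "\<beta> \<in> \<Delta>" if "\<alpha> \<^bold>\<rightarrow> \<beta> \<in> \<Delta>" "\<alpha> \<in> \<Delta>" for \<alpha> \<beta>
    using that provable.mp closed by blast
  note prime = maximal_unprovable_prime[OF \<Delta>]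
  have \<phi>: "\<phi> \<notin> \<Delta>" using \<Delta> closed by (auto simp: maximal_unprovable_def)
  have disj: "\<alpha> \<^bold>\<or> \<beta> \<in> \<Delta> \<longleftrightarrow> \<alpha> \<in> \<Delta> \<or> \<beta> \<in> \<Delta>" for \<alpha> \<beta>
    using prime[of \<alpha> \<beta>] mp[OF ax[OF Ax6[of \<alpha> \<beta>]]] mp[OF ax[OF Ax7[of \<beta> \<alpha>]]] by argo
  have conj: "\<alpha> \<^bold>\<and> \<beta> \<in> \<Delta> \<longleftrightarrow> \<alpha> \<in> \<Delta> \<and> \<beta> \<in> \<Delta>" for \<alpha> \<beta>
    using mp[OF mp[OF ax[OF Ax3[of \<alpha> \<beta>]]]] mp[OF ax[OF Ax4[of \<alpha> \<beta>]]]
      mp[OF ax[OF Ax5[of \<alpha> \<beta>]]] by argo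
  have imp: "\<alpha> \<^bold>\<rightarrow> \<beta> \<in> \<Delta> \<longleftrightarrow> \<alpha> \<notin> \<Delta> \<or> \<beta> \<in> \<Delta>" for \<alpha> \<beta>
    using prime[OF ax[OF Ax9[of \<alpha> \<beta>]]] mp[OF ax[OF Ax1[of \<beta> \<alpha>]]] mp[of \<alpha> \<beta>] by argo
  have up: "\<alpha> \<^bold>\<up> \<beta> \<in> \<Delta> \<longrightarrow> \<alpha> \<notin> \<Delta> \<or> \<beta> \<notin> \<Delta>" for \<alpha> \<beta>
    using mp[OF mp[OF mp[OF ax[OF Ip[of \<alpha> \<beta> \<phi>]]]]] \<phi> by argo
  have comm: "\<alpha> \<^bold>\<up> \<beta> \<in> \<Delta> \<longleftrightarrow> \<beta> \<^bold>\<up> \<alpha> \<in> \<Delta>" for \<alpha> \<beta>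
    using mp[OF ax[OF Comm[of \<alpha> \<beta>]]] mp[OF ax[OF Comm[of \<beta> \<alpha>]]] by argo
  have neg: "\<^bold>\<not> \<alpha> \<notin> \<Delta> \<longrightarrow> \<alpha> \<in> \<Delta>" for \<alpha>
    using prime[OF ax[OF Ax11[of \<alpha>]]] by argo
  show ?thesis
    unfolding nbI_bivaluation_def by (intro allI conjI disj conj imp up comm neg)
qed

theorem theorem6:
  fixes \<Gamma> :: "('v::countable) form set" and \<phi> :: "'v form"
  assumes "\<Gamma> \<Turnstile>nbI \<phi>"
  shows "\<Gamma> \<turnstile>nbI \<phi>"
proof (rule ccontr)
  assume "\<not> \<Gamma> \<turnstile>nbI \<phi>"
  then have "\<not> provable \<Gamma> \<phi>" using provable_imp_derives by blast
  then obtain \<Delta> where \<Delta>: "\<Gamma> \<subseteq> \<Delta>" "maximal_unprovable \<Delta> \<phi>" by (rule lindenbaum)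
  have "\<phi> \<in> \<Delta>"
    using assms maximal_unprovable_bivaluation[OF \<Delta>(2)] \<Delta>(1) by (auto simp: nbI_entails_def)
  with \<Delta>(2) show False using maximal_unprovable_closed by (auto simp: maximal_unprovable_def)
qed

end
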